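(* Let $N>1$ be an integer. For every $m\ge2$, the complete Dirichlet spectrum $\Lambda_m$ of $H_m$ is given by $$\Lambda_m=\{1,\,N,\,\phi_+(\lambda_{m-1}),\,\phi_-(\lambda_{m-1}):\lambda_{m-1}\in\Lambda_{m-1}\}.$$
   Context: Let $S=\{1,\dots,N\}$ and $\Sigma_N^+=S^{\mathbb{N}}$. For $m\ge 0$, $V_m\subset\Sigma_N^+$ is the set of sequences constant from position $m+1$ on; its elements are written $(p_1\cdots p_m\dot p_{m+1})=(p_1\cdots p_m p_{m+1}p_{m+1}\cdots)$. Thus $V_0\subset V_1\subset\cdots$ and $\#V_m=N^{m+1}$. For $p\in V_m$, $\mathcal{U}_{p,m}=\{(p_1\cdots p_m\dot l):l\in S\}\setminus\{p\}$ ($N-1$ points). $\ell(V_m)$ is the space of real functions on $V_m$. The difference operators $H_m:\ell(V_m)\to\ell(V_m)$ are given by $H_0u(p)=-(N-1)u(p)+\sum_{q\in\mathcal{U}_{p,0}}u(q)$ and, for $m\ge1$, $$H_mu(p)=\begin{cases}-(N-1)u(p)+\sum_{q\in\mathcal{U}_{p,m}}u(q), & p\in V_m\setminus V_{m-1},\\ H_{m-1}(u|_{V_{m-1}})(p)-(N-1)u(p)+\sum_{q\in\mathcal{U}_{p,m}}u(q), & p\in V_{m-1}.\end{cases}$$ For $m\ge1$, $\lambda_m\in\mathbb{R}$ is a Dirichlet eigenvalue of $H_m$ if there is $u_m\in\ell(V_m)$, $u_m\not\equiv0$, with $H_mu_m=-\lambda_mu_m$ on $V_m\setminus V_0$ and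 $u_m|_{V_0}=0$. $\Lambda_m$ denotes the Dirichlet spectrum of $H_m$, i.e. the set of all Dirichlet eigenvalues of $H_m$. $\phi_\pm(x)=\dfrac{N+x}{2}\left[1\pm\sqrt{1-\dfrac{4x}{(N+x)^2}}\,\right]$.
   Formalization: The identity is false for N = 2 (there Λ_2 = {1, (3±√5)/2} does not contain 2); the formal theorem states it as printed for N > 2, and for N = 2 with the element N removed from the right-hand side. *)

theory Defs
  imports Complex_Main
begin

text \<open>
  A sequence over the alphabet \<open>{1..N}\<close> is a function \<open>nat \<Rightarrow> nat\<close>. Indexing starts at 0,
  so the letter written \<open>p\<^sub>i\<close> on paper is \<open>p (i - 1)\<close>, and ``constant from position \<open>m + 1\<close> on''
  means constant from index \<open>m\<close> on.
\<close>

type_synonym sequence = "nat \<Rightarrow> nat"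

definition Sigma_plus :: "nat \<Rightarrow> sequence set" where
  "Sigma_plus N = {p. \<forall>i. p i \<in> {1..N}}"

definition V :: "nat \<Rightarrow> nat \<Rightarrow> sequence set" where
  "V N m = {p \<in> Sigma_plus N. \<forall>i\<ge>m. p i = p m}"

text \<open>\<open>dotted p m l\<close> is the point \<open>(p\<^sub>1 \<dots> p\<^sub>m l l l \<dots>)\<close>.\<close>

definition dotted :: "sequence \<Rightarrow> nat \<Rightarrow> nat \<Rightarrow> sequence" where
  "dotted p m l = (\<lambda>i. if i < m then p i else l)"

definition U :: "nat \<Rightarrow> sequence \<Rightarrow> nat \<Rightarrow> sequence set" where
  "U N p m = {dotted p m l | l. l \<in> {1..N}} - {p}"

text \<open>
  Real functions on \<open>V N m\<close> are represented by total functions on sequences. For \<open>p \<in> V N m\<close>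
  the value \<open>H N m u p\<close> depends only on the values of \<open>u\<close> on \<open>V N m\<close>, so the restriction of \<open>u\<close>
  to \<open>V N m\<close> in the recursive call is implicit; values at \<open>p \<notin> V N m\<close> are irrelevant.
\<close>

primrec H :: "nat \<Rightarrow> nat \<Rightarrow> (sequence \<Rightarrow> real) \<Rightarrow> sequence \<Rightarrow> real" where
  "H N 0 u p = - (real N - 1) * u p + (\<Sum>q\<in>U N p 0. u q)"
| "H N (Suc m) u p =
     (if p \<in> V N m
      then H N m u p - (real N - 1) * u p + (\<Sum>q\<in>U N p (Suc m). u q)
      else - (real N - 1) * u p + (\<Sum>q\<in>U N p (Suc m). u q))"

definition dirichlet_eigenvalue :: "nat \<Rightarrow> nat \<Rightarrow> real \<Rightarrow> bool" where
  "dirichlet_eigenvalue N m \<mu> \<longleftrightarrow>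
     (\<exists>u :: sequence \<Rightarrow> real.
        (\<exists>p\<in>V N m. u p \<noteq> 0) \<and>
        (\<forall>p\<in>V N m - V N 0. H N m u p = - \<mu> * u p) \<and>
        (\<forall>p\<in>V N 0. u p = 0))"

definition dirichlet_spectrum :: "nat \<Rightarrow> nat \<Rightarrow> real set" where
  "dirichlet_spectrum N m = {\<mu>. dirichlet_eigenvalue N m \<mu>}"

text \<open>
  For \<open>N \<ge> 2\<close> the radicand is positive whenever \<open>x \<noteq> - N\<close>. At \<open>x = - N\<close> the formula is undefined on
  paper and total here only by the convention \<open>x / 0 = 0\<close>.
\<close>

definition phi_plus :: "nat \<Rightarrow> real \<Rightarrow> real" where
  "phi_plus N x = (real N + x) / 2 * (1 + sqrt (1 - 4 * x / (real N + x)\<^sup>2))"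

definition phi_minus :: "nat \<Rightarrow> real \<Rightarrow> real" where
  "phi_minus N x = (real N + x) / 2 * (1 - sqrt (1 - 4 * x / (real N + x)\<^sup>2))"

end

theory Submission
  imports Defs
begin

text \<open>
  Each point \<open>p\<close> of \<open>V\<^sub>k\<close> carries its own complete graph on \<open>N\<close> vertices, consisting of \<open>p\<close> and
  \<open>N - 1\<close> points of \<open>V\<^sub>k\<^sub>+\<^sub>1 - V\<^sub>k\<close>. Let \<open>S\<close> be the sum of \<open>u\<close> over it. The eigenvalue equations
  at the new points read \<open>S = (N - \<lambda>) u\<close>; added up they give \<open>(1 - \<lambda>) S = (N - \<lambda>) u p\<close>.
  Eliminating \<open>S\<close> from the equation at \<open>p\<close> turns it, for \<open>\<lambda> \<noteq> 1\<close>, into the eigenvalue equation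
  of \<open>H\<^sub>k\<close> with eigenvalue \<open>x\<close>, where \<open>x (1 - \<lambda>) = \<lambda> (N - \<lambda>)\<close>. The solutions \<open>\<lambda>\<close> of this quadratic
  equation are \<open>\<phi>\<^sub>+ x\<close> and \<open>\<phi>\<^sub>- x\<close>. Since \<open>\<lambda> \<le> 0\<close> forces \<open>x \<le> 0\<close>, all eigenvalues are positive by
  induction; this avoids the junk value at \<open>x = - N\<close> and excludes \<open>\<lambda> = N\<close>, that is \<open>x = 0\<close>, for
  \<open>N = 2\<close>. The eigenvalue \<open>1\<close> comes from functions that are
  constant on the new neighbours of \<open>V\<^sub>0\<close>, and \<open>N\<close> from functions with mean zero on the new points
  of a single complete graph, which exist only for \<open>N > 2\<close>.
\<close>

section \<open>Points of \<open>V N m\<close> and replacement of their constant tail\<close>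

lemma dotted_dotted [simp]: "dotted (dotted p n l) n l' = dotted p n l'"
  by (auto simp: dotted_def)

lemma dotted_less [simp]: "i < n \<Longrightarrow> dotted p n l i = p i"
  by (simp add: dotted_def)

lemma dotted_at [simp]: "dotted p n l n = l"
  by (simp add: dotted_def)

lemma V_range: "p \<in> V N m \<Longrightarrow> p i \<in> {1..N}"
  by (auto simp: V_def Sigma_plus_def)

lemma dotted_mem_V: "p \<in> V N m \<Longrightarrow> l \<in> {1..N} \<Longrightarrow> dotted p n l \<in> V N n"
  by (auto simp: V_def Sigma_plus_def dotted_def)

lemma V_const: "p \<in> V N m \<Longrightarrow> i \<ge> m \<Longrightarrow> p i = p m"
  unfolding V_def by blast

lemma dotted_self:
  assumes "p \<in> V N n"
  shows "dotted p n (p n) = p"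
proof
  show "dotted p n (p n) i = p i" for i
    using V_const[OF assms, of i] by (simp add: dotted_def)
qed

lemma V_mono:
  assumes "m \<le> n"
  shows "V N m \<subseteq> V N n"
proof
  fix p assume p: "p \<in> V N m"
  have "p i = p n" if "i \<ge> n" for i
    using V_const[OF p, of i] V_const[OF p, of n] assms that by simp
  then show "p \<in> V N n" using p unfolding V_def by blast
qed

lemma mem_V_iff:
  assumes "q \<in> V N (Suc k)"
  shows "q \<in> V N k \<longleftrightarrow> q (Suc k) = q k"
proof
  assume "q \<in> V N k"
  then show "q (Suc k) = q k" by (rule V_const) simp
next
  assume eq: "q (Suc k) = q k"
  have "q i = q k" if "i \<ge> k" for i
    using V_const[OF assms, of i] eq that by (cases "i = k") auto
  then show "q \<in> V N k" using assms unfolding V_def by blast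
qed

text \<open>So a complete graph of level \<open>Suc k\<close> has exactly one old vertex; seen from
  any vertex \<open>q\<close> it is \<open>dotted q (Suc k) (q k)\<close>.\<close>

lemma dotted_mem_V_iff:
  assumes "p \<in> V N m" and "l \<in> {1..N}"
  shows "dotted p (Suc k) l \<in> V N k \<longleftrightarrow> l = p k"
  using mem_V_iff[OF dotted_mem_V[OF assms, of "Suc k"]] by simp

lemma dotted_parent:
  assumes "p \<in> V N k"
  shows "dotted p (Suc k) (p k) = p"
  using dotted_self[of p N "Suc k"] assms V_mono[of k "Suc k" N] mem_V_iff[of p N k] by auto

section \<open>Sums over complete graphs and the form of \<open>H\<close>\<close>

lemma sum_U:
  fixes u :: "sequence \<Rightarrow> real"
  assumes "p \<in> V N n"
  shows "(\<Sum>q\<in>U N p n. u q) = (\<Sum>l=1..N. u (dotted p n l)) - u p"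
proof -
  have inj: "inj_on (dotted p n) {1..N}"
    by (metis dotted_at inj_onI)
  have U: "U N p n = dotted p n ` {1..N} - {p}"
    by (auto simp: U_def)
  have "p \<in> dotted p n ` {1..N}"
    using dotted_self[OF assms] V_range[OF assms, of n] by (metis imageI)
  then show ?thesis
    by (simp add: U sum_diff1 sum.reindex[OF inj] del: One_nat_def)
qed

text \<open>This is S of the overview. Unlike the sum over \<open>U\<close>, it includes
  \<open>p\<close> itself and so takes the same value at all vertices of one complete graph.\<close>

definition fibre_sum :: "nat \<Rightarrow> nat \<Rightarrow> (sequence \<Rightarrow> real) \<Rightarrow> sequence \<Rightarrow> real" where
  "fibre_sum N k u p = (\<Sum>l=1..N. u (dotted p (Suc k) l))"

lemma fibre_sum_dotted [simp]: "fibre_sum N k u (dotted p (Suc k) l) = fibre_sum N k u p"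
  by (simp add: fibre_sum_def)

lemma H_Suc_eq:
  assumes "p \<in> V N (Suc k)"
  shows "H N (Suc k) u p =
    (if p \<in> V N k then H N k u p else 0) + fibre_sum N k u p - real N * u p"
  by (simp add: sum_U[OF assms] fibre_sum_def algebra_simps)

lemma H_cong:
  assumes "p \<in> V N k" and "\<And>q. q \<in> V N k \<Longrightarrow> u q = v q"
  shows "H N k u p = H N k v p"
  using assms
proof (induction k)
  case 0
  have "(\<Sum>l=1..N. u (dotted p 0 l)) = (\<Sum>l=1..N. v (dotted p 0 l))"
    using 0 dotted_mem_V by (intro sum.cong) blast+
  then show ?case using 0 by (simp add: sum_U)
next
  case (Suc k)
  have "H N k u p = H N k v p" if "p \<in> V N k"
    using that Suc.IH Suc.prems(2) V_mono[of k "Suc k" N] by auto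
  moreover have "fibre_sum N k u p = fibre_sum N k v p"
    using Suc.prems dotted_mem_V unfolding fibre_sum_def by (intro sum.cong) blast+
  ultimately show ?case
    using Suc.prems by (simp only: H_Suc_eq split: if_split) simp
qed

lemma H_zero: "H N k (\<lambda>_. 0) p = 0"
  by (induction k) auto

lemma H_eq_0:
  assumes "p \<in> V N k" and "\<And>q. q \<in> V N k \<Longrightarrow> u q = 0"
  shows "H N k u p = 0"
  using H_cong[of p N k u "\<lambda>_. 0"] assms by (simp add: H_zero)

section \<open>Dirichlet spectra\<close>

lemma dirichlet_spectrum_0: "dirichlet_spectrum N 0 = {}"
  by (auto simp: dirichlet_spectrum_def dirichlet_eigenvalue_def)

text \<open>Separates the equations at new points, which involve a single complete graph each, from
  those at old interior points.\<close>

lemma mem_spectrum_Suc_iff: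
  "\<mu> \<in> dirichlet_spectrum N (Suc k) \<longleftrightarrow>
    (\<exists>u. (\<exists>p\<in>V N (Suc k). u p \<noteq> 0) \<and>
      (\<forall>p\<in>V N (Suc k) - V N k. fibre_sum N k u p = (real N - \<mu>) * u p) \<and>
      (\<forall>p\<in>V N k - V N 0. H N k u p + fibre_sum N k u p = (real N - \<mu>) * u p) \<and>
      (\<forall>p\<in>V N 0. u p = 0))"
proof -
  have sub: "V N 0 \<subseteq> V N k" "V N k \<subseteq> V N (Suc k)"
    by (simp_all add: V_mono)
  have "(\<forall>p\<in>V N (Suc k) - V N 0. H N (Suc k) u p = - \<mu> * u p) \<longleftrightarrow>
      (\<forall>p\<in>V N (Suc k) - V N k. H N (Suc k) u p = - \<mu> * u p) \<and>
      (\<forall>p\<in>V N k - V N 0. H N (Suc k) u p = - \<mu> * u p)" for u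
    using sub by blast
  moreover have "(\<forall>p\<in>V N (Suc k) - V N k. H N (Suc k) u p = - \<mu> * u p) \<longleftrightarrow>
      (\<forall>p\<in>V N (Suc k) - V N k. fibre_sum N k u p = (real N - \<mu>) * u p)" for u
    by (intro ball_cong refl) (auto simp only: H_Suc_eq Diff_iff if_False algebra_simps)
  moreover have "(\<forall>p\<in>V N k - V N 0. H N (Suc k) u p = - \<mu> * u p) \<longleftrightarrow>
      (\<forall>p\<in>V N k - V N 0.
        H N k u p + fibre_sum N k u p = (real N - \<mu>) * u p)" for u
  proof (intro ball_cong refl)
    fix p assume "p \<in> V N k - V N 0"
    then have "p \<in> V N k" "p \<in> V N (Suc k)" using sub by auto
    then show "(H N (Suc k) u p = - \<mu> * u p) =
        (H N k u p + fibre_sum N k u p = (real N - \<mu>) * u p)"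
      by (simp only: H_Suc_eq if_True) (auto simp: algebra_simps)
  qed
  ultimately show ?thesis
    by (simp only: dirichlet_spectrum_def dirichlet_eigenvalue_def mem_Collect_eq conj_assoc)
qed

section \<open>Passage between the levels \<open>k\<close> and \<open>Suc k\<close>\<close>

lemma sum_fibre:
  fixes u :: "sequence \<Rightarrow> real"
  assumes p: "p \<in> V N k"
    and c: "\<And>l. l \<in> {1..N} \<Longrightarrow> l \<noteq> p k \<Longrightarrow> u (dotted p (Suc k) l) = c"
  shows "fibre_sum N k u p = u p + (real N - 1) * c"
proof -
  have pk: "p k \<in> {1..N}" by (rule V_range[OF p])
  have "(\<Sum>l=1..N. u (dotted p (Suc k) l)) =
      u p + (\<Sum>l\<in>{1..N} - {p k}. u (dotted p (Suc k) l))"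
    using sum.remove[OF _ pk, of "\<lambda>l. u (dotted p (Suc k) l)"]
    by (simp add: dotted_parent[OF p])
  also have "(\<Sum>l\<in>{1..N} - {p k}. u (dotted p (Suc k) l)) = (\<Sum>l\<in>{1..N} - {p k}. c)"
    using c by (intro sum.cong) auto
  also have "\<dots> = (real N - 1) * c"
    using pk by (simp add: of_nat_diff)
  finally show ?thesis by (simp only: fibre_sum_def)
qed

text \<open>Multiplying S by \<open>real N - \<mu>\<close> turns each of the N - 1 new terms into S.
  Nothing is divided, so \<mu> = N and \<mu> = 1 are covered.\<close>

lemma fibre_identity:
  fixes u :: "sequence \<Rightarrow> real"
  assumes new: "\<And>q. q \<in> V N (Suc k) - V N k \<Longrightarrow>
      fibre_sum N k u q = (real N - \<mu>) * u q"
    and p: "p \<in> V N k"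
  shows "(1 - \<mu>) * fibre_sum N k u p = (real N - \<mu>) * u p"
proof -
  let ?S = "fibre_sum N k u p"
  have eq: "(real N - \<mu>) * u (dotted p (Suc k) l) = ?S" if "l \<in> {1..N}" "l \<noteq> p k" for l
    using new[of "dotted p (Suc k) l"] that dotted_mem_V[OF p, of l "Suc k"]
      dotted_mem_V_iff[OF p, of l k] by simp
  have "(real N - \<mu>) * ?S = fibre_sum N k (\<lambda>q. (real N - \<mu>) * u q) p"
    by (simp add: fibre_sum_def sum_distrib_left)
  also have "\<dots> = (real N - \<mu>) * u p + (real N - 1) * ?S"
    by (rule sum_fibre[OF p]) (rule eq)
  finally show ?thesis by (simp add: algebra_simps)
qed

text \<open>The eigenfunction is restricted to \<open>V N k\<close>. The assumption on \<mu> = N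
  rules out eigenfunctions that live on new points only.\<close>

lemma spectrum_descend:
  assumes mem: "\<mu> \<in> dirichlet_spectrum N (Suc k)" and "\<mu> \<noteq> 1" and N: "\<mu> = real N \<Longrightarrow> N = 2"
  shows "\<mu> * (real N - \<mu>) / (1 - \<mu>) \<in> dirichlet_spectrum N k"
proof -
  obtain u where nz: "\<exists>p\<in>V N (Suc k). u p \<noteq> 0"
    and new: "\<And>p. p \<in> V N (Suc k) - V N k \<Longrightarrow>
      fibre_sum N k u p = (real N - \<mu>) * u p"
    and old: "\<And>p. p \<in> V N k - V N 0 \<Longrightarrow>
      H N k u p + fibre_sum N k u p = (real N - \<mu>) * u p"
    and bd: "\<forall>p\<in>V N 0. u p = 0"
    using mem unfolding mem_spectrum_Suc_iff by blast
  have fib: "(1 - \<mu>) * fibre_sum N k u p = (real N - \<mu>) * u p"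
    if "p \<in> V N k" for p
    using fibre_identity[of N k u \<mu> p] new that by blast
  have "\<exists>p\<in>V N k. u p \<noteq> 0"
  proof (rule ccontr)
    assume "\<not> ?thesis"
    then have z: "u p = 0" if "p \<in> V N k" for p using that by blast
    obtain q where q: "q \<in> V N (Suc k)" "u q \<noteq> 0" using nz by blast
    then have qk: "q \<notin> V N k" using z by blast
    define p where "p = dotted q (Suc k) (q k)"
    have p: "p \<in> V N k" and pk: "p k = q k"
      using dotted_mem_V_iff[OF q(1) V_range[OF q(1)]] by (simp_all add: p_def)
    have S0: "fibre_sum N k u q = 0"
      using fib[OF p] z[OF p] \<open>\<mu> \<noteq> 1\<close> by (simp add: p_def)
    show False
    proof (cases "\<mu> = real N")
      case False
      then show False using S0 new[of q] q qk by simp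
    next
      \<comment> \<open>The equations at new points only say S = 0 here, but with two letters
        \<open>q\<close> is the sole new vertex of its graph, so S =
        \<open>u p + u q\<close>.\<close>
      case True
      then have "N = 2" by (rule N)
      have "q (Suc k) \<noteq> q k" using mem_V_iff[OF q(1)] qk by simp
      moreover have "q (Suc k) \<in> {1..N}" "q k \<in> {1..N}" using V_range[OF q(1)] by blast+
      ultimately have "l = q (Suc k)" if "l \<in> {1..N}" "l \<noteq> p k" for l
        using \<open>N = 2\<close> that pk by auto
      then have "u (dotted p (Suc k) l) = u q" if "l \<in> {1..N}" "l \<noteq> p k" for l
        using that dotted_self[OF q(1)] by (simp add: p_def)
      from sum_fibre[where u=u, OF p this] have "u q = 0"
        using S0 z[OF p] \<open>N = 2\<close> by (simp add: p_def)
      then show False using q by simp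
    qed
  qed
  moreover have "H N k u p = - (\<mu> * (real N - \<mu>) / (1 - \<mu>)) * u p" if "p \<in> V N k - V N 0" for p
  proof -
    have "fibre_sum N k u p = (real N - \<mu>) * u p / (1 - \<mu>)"
      using fib[of p] that \<open>\<mu> \<noteq> 1\<close> by (simp add: field_simps)
    then have "H N k u p = (real N - \<mu>) * u p - (real N - \<mu>) * u p / (1 - \<mu>)"
      using old[OF that] by simp
    also have "\<dots> = - (\<mu> * (real N - \<mu>) / (1 - \<mu>)) * u p"
      using \<open>\<mu> \<noteq> 1\<close> by (simp add: divide_simps) (simp add: algebra_simps)
    finally show ?thesis .
  qed
  ultimately show ?thesis
    using bd unfolding dirichlet_spectrum_def dirichlet_eigenvalue_def by blast
qed

lemma spectrum_pos:
  assumes "N > 1" and "\<mu> \<in> dirichlet_spectrum N k"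
  shows "\<mu> > 0"
  using assms(2)
proof (induction k arbitrary: \<mu>)
  case 0
  then show ?case by (simp add: dirichlet_spectrum_0)
next
  case (Suc k)
  show ?case
  proof (rule ccontr)
    assume "\<not> \<mu> > 0"
    then have le: "\<mu> \<le> 0" by simp
    then have "\<mu> * (real N - \<mu>) / (1 - \<mu>) \<in> dirichlet_spectrum N k"
      using Suc.prems \<open>N > 1\<close> by (intro spectrum_descend) auto
    then have "\<mu> * (real N - \<mu>) / (1 - \<mu>) > 0" by (rule Suc.IH)
    moreover have "\<mu> * (real N - \<mu>) / (1 - \<mu>) \<le> 0"
      using le by (intro divide_nonpos_pos mult_nonpos_nonneg) auto
    ultimately show False by simp
  qed
qed

lemma spectrum_ascend:
  assumes mem: "x \<in> dirichlet_spectrum N k" and "\<mu> \<noteq> 1"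
    and x: "x * (1 - \<mu>) = \<mu> * (real N - \<mu>)"
  shows "\<mu> \<in> dirichlet_spectrum N (Suc k)"
proof -
  obtain u where nz: "\<exists>p\<in>V N k. u p \<noteq> 0"
    and ev: "\<And>p. p \<in> V N k - V N 0 \<Longrightarrow> H N k u p = - x * u p"
    and bd: "\<forall>p\<in>V N 0. u p = 0"
    using mem unfolding dirichlet_spectrum_def dirichlet_eigenvalue_def by blast
  \<comment> \<open>Where \<mu> differs from N, the value at new vertices is forced: S / (N - \<mu>)
    = \<open>u p / (1 - \<mu>)\<close>, with \<open>p\<close> the old vertex. The second form also
    serves \<mu> = N.\<close>
  define v where "v = (\<lambda>q. if q \<in> V N k then u q else u (dotted q (Suc k) (q k)) / (1 - \<mu>))"
  have v_old: "v p = u p" if "p \<in> V N k" for p using that by (simp add: v_def)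
  have S: "fibre_sum N k v p = (real N - \<mu>) * (u p / (1 - \<mu>))"
    if p: "p \<in> V N k" for p
  proof -
    have "v (dotted p (Suc k) l) = u p / (1 - \<mu>)" if "l \<in> {1..N}" "l \<noteq> p k" for l
      using that dotted_mem_V_iff[OF p, of l k] by (simp add: v_def dotted_parent[OF p])
    from sum_fibre[where u=v, OF p this] show ?thesis
      using \<open>\<mu> \<noteq> 1\<close> by (simp add: v_old[OF p] divide_simps) (simp add: algebra_simps)
  qed
  have "\<exists>p\<in>V N (Suc k). v p \<noteq> 0"
    using nz v_old V_mono[of k "Suc k" N] by force
  moreover have "fibre_sum N k v q = (real N - \<mu>) * v q"
    if "q \<in> V N (Suc k) - V N k" for q
  proof -
    have "dotted q (Suc k) (q k) \<in> V N k"
      using dotted_mem_V_iff[of q N "Suc k" "q k" k] V_range[of q N "Suc k" k] that by simp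
    from S[OF this] show ?thesis using that by (simp add: v_def)
  qed
  moreover have "H N k v p + fibre_sum N k v p = (real N - \<mu>) * v p"
    if p: "p \<in> V N k - V N 0" for p
  proof -
    have pk: "p \<in> V N k" using p by simp
    have "x = \<mu> * (real N - \<mu>) / (1 - \<mu>)"
      using x \<open>\<mu> \<noteq> 1\<close> by (simp add: field_simps)
    then have "H N k v p = - (\<mu> * (real N - \<mu>) / (1 - \<mu>)) * u p"
      using H_cong[of p N k v u] v_old ev[OF p] pk by simp
    then show ?thesis
      using \<open>\<mu> \<noteq> 1\<close> by (simp add: S[OF pk] v_old[OF pk] divide_simps) (simp add: algebra_simps)
  qed
  moreover have "\<forall>p\<in>V N 0. v p = 0"
    using bd v_old V_mono[of 0 k N] by auto
  ultimately show ?thesis unfolding mem_spectrum_Suc_iff by blast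
qed

section \<open>The eigenvalues 1 and N\<close>

lemma const_mem_V: "N > 0 \<Longrightarrow> (\<lambda>_. 1) \<in> V N n"
  by (simp add: V_def Sigma_plus_def)

text \<open>Around a point of \<open>V N 0\<close> the new vertices carry 1 and S = N - 1, as
  required there; the mismatch at the boundary point itself is harmless, since no eigenvalue
  equation is imposed on \<open>V N 0\<close>.\<close>

lemma one_mem_spectrum:
  assumes "N > 1"
  shows "1 \<in> dirichlet_spectrum N (Suc k)"
proof -
  define v :: "sequence \<Rightarrow> real"
    where "v = (\<lambda>q. if q \<notin> V N k \<and> dotted q (Suc k) (q k) \<in> V N 0 then 1 else 0)"
  have v_old: "v p = 0" if "p \<in> V N k" for p using that by (simp add: v_def)
  have S: "fibre_sum N k v p = (if p \<in> V N 0 then real N - 1 else 0)"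
    if p: "p \<in> V N k" for p
  proof -
    have "v (dotted p (Suc k) l) = (if p \<in> V N 0 then 1 else 0)" if "l \<in> {1..N}" "l \<noteq> p k" for l
      using that dotted_mem_V_iff[OF p, of l k] by (simp add: v_def dotted_parent[OF p])
    from sum_fibre[where u=v, OF p this] show ?thesis by (simp add: v_old[OF p])
  qed
  let ?c = "\<lambda>_::nat. 1::nat"
  have c: "?c \<in> V N n" for n using const_mem_V assms by simp
  have "dotted ?c (Suc k) 2 \<in> V N (Suc k)" "dotted ?c (Suc k) 2 \<notin> V N k"
    using dotted_mem_V[OF c[of k], of 2 "Suc k"] dotted_mem_V_iff[OF c[of k], of 2 k] assms by auto
  moreover have "v (dotted ?c (Suc k) 2) = 1"
    using dotted_mem_V_iff[OF c[of k], of 2 k] dotted_parent[OF c[of k]] c[of 0] assms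
    by (simp add: v_def)
  ultimately have "\<exists>p\<in>V N (Suc k). v p \<noteq> 0" by force
  moreover have "fibre_sum N k v q = (real N - 1) * v q"
    if "q \<in> V N (Suc k) - V N k" for q
  proof -
    have "dotted q (Suc k) (q k) \<in> V N k"
      using dotted_mem_V_iff[of q N "Suc k" "q k" k] V_range[of q N "Suc k" k] that by simp
    from S[OF this] show ?thesis using that by (simp add: v_def)
  qed
  moreover have "H N k v p + fibre_sum N k v p = (real N - 1) * v p"
    if "p \<in> V N k - V N 0" for p
    using H_eq_0[of p N k v] v_old S[of p] that by simp
  moreover have "\<forall>p\<in>V N 0. v p = 0"
    using v_old V_mono[of 0 k N] by auto
  ultimately show ?thesis unfolding mem_spectrum_Suc_iff by blast
qed

lemma N_mem_spectrum:
  assumes "N > 2"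
  shows "real N \<in> dirichlet_spectrum N (Suc k)"
proof -
  let ?c = "\<lambda>_::nat. 1::nat"
  \<comment> \<open>Letter 1 belongs to the old vertex \<open>?c\<close>, where the function must
    vanish; letters 2 and 3 carry opposite values, so every S is 0.\<close>
  define g :: "nat \<Rightarrow> real" where "g l = (if l = 2 then 1 else 0) - (if l = 3 then 1 else 0)" for l
  define v :: "sequence \<Rightarrow> real"
    where "v = (\<lambda>q. if dotted q (Suc k) (q k) = ?c then g (q (Suc k)) else 0)"
  have c: "?c \<in> V N n" for n using const_mem_V assms by simp
  have g: "(\<Sum>l=1..N. g l) = 0"
    using assms by (simp add: g_def sum_subtractf)
  have v_old: "v p = 0" if "p \<in> V N k" for p
  proof -
    have "p \<in> V N (Suc k)" using that V_mono[of k "Suc k" N] by auto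
    then have "p (Suc k) = p k" using mem_V_iff[of p N k] that by simp
    then show ?thesis using dotted_parent[OF that] by (auto simp: v_def g_def)
  qed
  have S: "fibre_sum N k v q = 0" for q
    using g by (cases "dotted q (Suc k) (q k) = ?c") (simp_all add: fibre_sum_def v_def del: One_nat_def)
  have "v (dotted ?c (Suc k) 2) = 1"
    using dotted_parent[OF c[of k]] by (simp add: v_def g_def)
  moreover have "dotted ?c (Suc k) 2 \<in> V N (Suc k)"
    using dotted_mem_V[OF c[of k], of 2 "Suc k"] assms by simp
  ultimately have "\<exists>p\<in>V N (Suc k). v p \<noteq> 0" by force
  moreover have "H N k v p = 0" if "p \<in> V N k" for p
    using H_eq_0[of p N k v] v_old that by simp
  moreover have "\<forall>p\<in>V N 0. v p = 0"
    using v_old V_mono[of 0 k N] by auto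
  ultimately show ?thesis unfolding mem_spectrum_Suc_iff by (intro exI[of _ v]) (simp add: S)
qed

section \<open>The quadratic equation and the recursion for the spectra\<close>

lemma phi_roots:
  assumes "N > 1" and "x > 0"
  shows "\<mu> \<in> {phi_plus N x, phi_minus N x} \<longleftrightarrow> x * (1 - \<mu>) = \<mu> * (real N - \<mu>)"
proof -
  define b where "b = real N + x"
  define r where "r = sqrt (1 - 4 * x / b\<^sup>2)"
  have b: "b > 0" using assms by (simp add: b_def)
  \<comment> \<open>Rewriting the discriminant of \<mu>^2 - b \<mu> + x in this way shows that it is
    nonnegative, so both roots are real.\<close>
  have "b\<^sup>2 - 4 * x = (x + real N - 2)\<^sup>2 + 4 * (real N - 1)"
    by (simp add: b_def power2_eq_square algebra_simps)
  also have "\<dots> \<ge> 0" using assms by simp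
  finally have "1 - 4 * x / b\<^sup>2 \<ge> 0" using b by (simp add: divide_simps)
  then have "r\<^sup>2 = 1 - 4 * x / b\<^sup>2" by (simp add: r_def)
  then have br: "(b * r)\<^sup>2 = b\<^sup>2 - 4 * x"
    using b by (simp add: power_mult_distrib right_diff_distrib)
  have "\<mu> \<in> {phi_plus N x, phi_minus N x} \<longleftrightarrow> 2 * \<mu> - b = b * r \<or> 2 * \<mu> - b = - (b * r)"
    unfolding phi_plus_def phi_minus_def b_def[symmetric] r_def[symmetric]
    by (auto simp: field_simps)
  also have "\<dots> \<longleftrightarrow> (2 * \<mu> - b)\<^sup>2 = (b * r)\<^sup>2"
    by (simp add: power2_eq_iff)
  also have "\<dots> \<longleftrightarrow> x * (1 - \<mu>) = \<mu> * (real N - \<mu>)"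
    unfolding br by (auto simp: b_def power2_eq_square algebra_simps)
  finally show ?thesis .
qed

lemma spectrum_Suc:
  assumes "N > 1"
  shows "dirichlet_spectrum N (Suc k) =
    {1} \<union> (if N > 2 then {real N} else {}) \<union>
    (\<Union>x\<in>dirichlet_spectrum N k. {phi_plus N x, phi_minus N x})"
    (is "?L = ?R")
proof (intro set_eqI iffI)
  fix \<mu> assume mem: "\<mu> \<in> ?L"
  show "\<mu> \<in> ?R"
  proof (cases "\<mu> = 1 \<or> (\<mu> = real N \<and> N > 2)")
    case True
    then show ?thesis by auto
  next
    case False
    define x where "x = \<mu> * (real N - \<mu>) / (1 - \<mu>)"
    have x: "x \<in> dirichlet_spectrum N k"
      unfolding x_def using False assms by (intro spectrum_descend[OF mem]) auto
    have "x * (1 - \<mu>) = \<mu> * (real N - \<mu>)"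
      using False by (simp add: x_def)
    then show ?thesis
      using phi_roots[OF assms spectrum_pos[OF assms x]] x by blast
  qed
next
  fix \<mu> assume "\<mu> \<in> ?R"
  then consider "\<mu> = 1" | "\<mu> = real N" "N > 2"
    | x where "x \<in> dirichlet_spectrum N k" "\<mu> \<in> {phi_plus N x, phi_minus N x}"
    by (auto split: if_splits)
  then show "\<mu> \<in> ?L"
  proof cases
    case 3
    have eq: "x * (1 - \<mu>) = \<mu> * (real N - \<mu>)"
      using phi_roots[OF assms spectrum_pos[OF assms 3(1)]] 3(2) by blast
    \<comment> \<open>At \<mu> = 1 the equation would read 0 = N - 1.\<close>
    then have "\<mu> \<noteq> 1" using assms by auto
    then show ?thesis using spectrum_ascend[OF 3(1)] eq by blast
  qed (use one_mem_spectrum[OF assms] N_mem_spectrum in auto)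
qed

text \<open>The case N = 2 stands apart because N is then no eigenvalue: it would descend to x = 0
  one level below, against positivity.\<close>

theorem theorem6p2:
  fixes N m :: nat
  assumes "N > 1" and "m \<ge> 2"
  shows "(N > 2 \<longrightarrow>
           dirichlet_spectrum N m =
             {1, real N} \<union> (\<Union>x\<in>dirichlet_spectrum N (m - 1). {phi_plus N x, phi_minus N x})) \<and>
         (N = 2 \<longrightarrow>
           dirichlet_spectrum N m =
             {1} \<union> (\<Union>x\<in>dirichlet_spectrum N (m - 1). {phi_plus N x, phi_minus N x}))"
proof -
  have "Suc (m - 1) = m" using assms by simp
  then show ?thesis using spectrum_Suc[OF assms(1), of "m - 1"] by auto
qed

end
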